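(* Let $n\geqslant 3$ be an odd integer and $m\geqslant 1$ an integer, and let $C_n$ denote the cycle graph on $n$ vertices. The number $p(2m)$ of closed walks of length $2m$ on $C_n$ is $$p(2m)=\begin{cases}\displaystyle 2n\Bigl(\binom{2m-1}{m-1}+\sum_{r=1}^{\lfloor m/n\rfloor}\binom{2m}{m-rn}\Bigr), & m\geqslant n,\\[2mm] \displaystyle 2n\binom{2m-1}{m-1}, & m<n.\end{cases}$$
   Context: A walk of length $r$ in a graph is a sequence $(v_0,v_1,\dots,v_r)$ of vertices (not necessarily distinct) such that $v_{i-1}$ and $v_i$ are adjacent for each $i=1,\dots,r$; it is closed if $v_0=v_r$. The number of closed walks of length $r$ is the number of such sequences, i.e. the trace of $A^r$ where $A$ is the adjacency matrix. The cycle graph $C_n$ has vertices $0,1,\dots,n-1$ with $i$ adjacent to $j$ iff $i-j\equiv\pm1\pmod n$. $\lfloor x\rfloor$ is the floor of $x$. *)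

theory Defs
  imports "Graph_Theory.Graph_Theory" "HOL-Number_Theory.Cong"
begin

definition cycle_graph :: "nat \<Rightarrow> nat pair_pre_digraph" where
  "cycle_graph n = \<lparr> pverts = {..<n},
     parcs = {(i, j). i < n \<and> j < n \<and>
       ([int i - int j = 1] (mod int n) \<or> [int i - int j = - 1] (mod int n))} \<rparr>"

lemma pair_graph_cycle_graph:
  assumes "2 \<le> n"
  shows "pair_graph (cycle_graph n)"
proof
  show "finite (parcs (cycle_graph n))"
    by (rule finite_subset[of _ "{..<n} \<times> {..<n}"]) (auto simp: cycle_graph_def)
  show "symmetric (with_proj (cycle_graph n))"
  proof -
    have "[int j - int i = - c] (mod int n)" if "[int i - int j = c] (mod int n)" for i j c
      using that cong_minus_minus_iff[of "int i - int j" c "int n"] by simp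
    from this[of _ _ 1] this[of _ _ "- 1"] show ?thesis
      by (auto simp: symmetric_def cycle_graph_def intro!: symI)
  qed
  show "fst e \<noteq> snd e" if "e \<in> parcs (cycle_graph n)" for e
    using that assms by (auto simp: cycle_graph_def cong_iff_dvd_diff)
qed (auto simp: cycle_graph_def)

text \<open>A walk is its vertex sequence \<open>(v\<^sub>0, \<dots>, v\<^sub>r)\<close>, so closed walks that
  differ only in starting point or direction are counted separately.\<close>

definition closed_walks :: "('a, 'b) pre_digraph \<Rightarrow> nat \<Rightarrow> 'a vwalk set" where
  "closed_walks G r = {p. vwalk p G \<and> vwalk_length p = r \<and> hd p = last p}"

end

theory Submission
  imports Defs
begin

text \<open>A walk of length \<open>k\<close> on \<open>C\<^sub>n\<close> from \<open>u\<close> to \<open>v\<close> is a choice of a sign for each of its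
  \<open>k\<close> steps; with \<open>j\<close> positive steps it ends at \<open>v\<close> iff \<open>n\<close> divides \<open>v - u + k - 2j\<close>.
  For \<open>u = v\<close> and \<open>k = 2m\<close> with \<open>n\<close> odd this means \<open>j \<equiv> m (mod n)\<close>, so the count is the sum of
  the binomial coefficients \<open>2m choose (m \<plusminus> rn)\<close>, which pair up by symmetry.\<close>

definition walks_between :: "('a, 'b) pre_digraph \<Rightarrow> nat \<Rightarrow> 'a \<Rightarrow> 'a \<Rightarrow> 'a vwalk set" where
  "walks_between G k u v = {p. vwalk p G \<and> vwalk_length p = k \<and> hd p = u \<and> last p = v}"

text \<open>The displacement \<open>c\<close> is an arbitrary integer, not a reduced residue, so
  that removing one step is plain addition or subtraction of 1.\<close>

definition signed_step_count :: "nat \<Rightarrow> nat \<Rightarrow> int \<Rightarrow> nat" where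
  "signed_step_count n k c = (\<Sum>j\<le>k. if int n dvd c + int k - 2 * int j then k choose j else 0)"

lemma signed_step_count_0: "signed_step_count n 0 c = (if int n dvd c then 1 else 0)"
  by (simp add: signed_step_count_def)

text \<open>Pascal's rule in the guise of a walk recursion: a positive first step leaves
  displacement \<open>c - 1\<close> to cover, a negative one leaves \<open>c + 1\<close>.\<close>

lemma signed_step_count_Suc:
  "signed_step_count n (Suc k) c = signed_step_count n k (c - 1) + signed_step_count n k (c + 1)"
proof -
  let ?g = "\<lambda>j b. if int n dvd c + int (Suc k) - 2 * int j then b else (0::nat)"
  have "signed_step_count n (Suc k) c = ?g 0 1 + (\<Sum>j\<le>k. ?g (Suc j) (Suc k choose Suc j))"
    unfolding signed_step_count_def by (subst sum.atMost_Suc_shift) simp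
  also have "(\<Sum>j\<le>k. ?g (Suc j) (Suc k choose Suc j)) =
      (\<Sum>j\<le>k. ?g (Suc j) (k choose j)) + (\<Sum>j\<le>k. ?g (Suc j) (k choose Suc j))"
    by (subst sum.distrib[symmetric]) (rule sum.cong, auto)
  \<comment> \<open>The split-off term for \<open>j = 0\<close> rejoins the \<open>Suc j\<close>
    terms. The new top term is harmless, since \<open>k choose Suc k\<close> is 0.\<close>
  also have "?g 0 1 + \<dots> = (\<Sum>j\<le>k. ?g (Suc j) (k choose j)) + (\<Sum>j\<le>Suc k. ?g j (k choose j))"
    by (subst sum.atMost_Suc_shift) simp
  also have "(\<Sum>j\<le>Suc k. ?g j (k choose j)) = signed_step_count n k (c + 1)"
    unfolding signed_step_count_def by (simp add: algebra_simps)
  also have "(\<Sum>j\<le>k. ?g (Suc j) (k choose j)) = signed_step_count n k (c - 1)"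
    unfolding signed_step_count_def by (simp add: algebra_simps)
  finally show ?thesis .
qed

lemma signed_step_count_cong:
  assumes "[c = d] (mod int n)"
  shows "signed_step_count n k c = signed_step_count n k d"
proof -
  have "int n dvd c + int k - 2 * int j \<longleftrightarrow> int n dvd d + int k - 2 * int j" for j
    using assms by (intro cong_dvd_iff cong_diff cong_add) auto
  then show ?thesis
    unfolding signed_step_count_def by simp
qed

section \<open>Walks with prescribed endpoints in a digraph\<close>

lemma walks_between_0:
  "walks_between G 0 u v = (if u = v \<and> u \<in> verts G then {[u]} else {})"
proof -
  have "p \<in> walks_between G 0 u v \<longleftrightarrow> p = [u] \<and> u = v \<and> u \<in> verts G" for p
    by (cases p) (auto simp: walks_between_def vwalk_def)
  then show ?thesis
    by auto
qed

lemma walks_between_Suc: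
  assumes "wf_digraph G"
  shows "walks_between G (Suc k) u v =
    (#) u ` (\<Union>w \<in> {w. (u, w) \<in> arcs_ends G}. walks_between G k w v)"
proof (intro equalityI subsetI)
  fix p assume p: "p \<in> walks_between G (Suc k) u v"
  then obtain w q where "p = u # w # q"
    by (cases p; cases "tl p") (auto simp: walks_between_def)
  with p show "p \<in> (#) u ` (\<Union>w \<in> {w. (u, w) \<in> arcs_ends G}. walks_between G k w v)"
    by (auto simp: walks_between_def vwalk_def)
next
  \<comment> \<open>Well-formedness turns the arc from \<open>u\<close> to \<open>w\<close> into
    membership of \<open>u\<close> in \<open>verts G\<close>, which \<open>vwalk\<close>
    demands.\<close>
  interpret wf_digraph G by fact
  fix p assume "p \<in> (#) u ` (\<Union>w \<in> {w. (u, w) \<in> arcs_ends G}. walks_between G k w v)"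
  then obtain w q where "p = u # q" "(u, w) \<in> arcs_ends G" "q \<in> walks_between G k w v"
    by auto
  then show "p \<in> walks_between G (Suc k) u v"
    by (cases q) (auto simp: walks_between_def vwalk_def)
qed

lemma finite_walks_between:
  assumes "fin_digraph G"
  shows "finite (walks_between G k u v)"
proof (induction k arbitrary: u)
  case 0
  show ?case by (simp add: walks_between_0)
next
  case (Suc k)
  interpret fin_digraph G by fact
  have "finite {w. (u, w) \<in> arcs_ends G}"
    by (rule finite_subset[of _ "snd ` arcs_ends G"]) (force, simp add: arcs_ends_def)
  with Suc show ?case
    by (simp add: walks_between_Suc[OF wf_digraph_axioms])
qed

section \<open>Walks on the cycle\<close>

lemma cong_less_imp_eq:
  fixes x y n :: nat
  assumes "x < n" "y < n" "[int x = int y] (mod int n)"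
  shows "x = y"
  using assms by (simp add: cong_int_iff cong_less_modulus_unique_nat)

lemma cycle_graph_neighbours:
  assumes "n \<ge> 3" "u < n"
  obtains s t where "s < n" "t < n" "s \<noteq> t"
    "[int s = int u + 1] (mod int n)" "[int t = int u - 1] (mod int n)"
    "{w. (u, w) \<in> arcs_ends (with_proj (cycle_graph n))} = {s, t}"
proof -
  define s where "s = nat ((int u + 1) mod int n)"
  define t where "t = nat ((int u - 1) mod int n)"
  have lt: "s < n" "t < n"
    using assms by (auto simp: s_def t_def nat_less_iff)
  have s: "[int s = int u + 1] (mod int n)" and t: "[int t = int u - 1] (mod int n)"
    using assms by (auto simp: s_def t_def cong_def)
  have "s \<noteq> t"
  proof
    assume "s = t"
    with s t have "[int u + 1 = int u - 1] (mod int n)"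
      using cong_sym cong_trans by blast
    \<comment> \<open>The two neighbours differ by 2 modulo \<open>n\<close>, and 2 is no multiple
      of \<open>n\<close> once \<open>n \<ge> 3\<close>.\<close>
    then have "int n dvd 2"
      by (simp add: cong_iff_dvd_diff)
    with assms show False
      by (auto dest: zdvd_imp_le)
  qed
  moreover have "{w. (u, w) \<in> arcs_ends (with_proj (cycle_graph n))} = {s, t}"
  proof -
    \<comment> \<open>Adjacency is phrased through \<open>u - w\<close>, so the value 1 means a step
      down to \<open>t\<close> and the value -1 a step up to \<open>s\<close>.\<close>
    have "[int u - int w = 1] (mod int n) \<longleftrightarrow> w = t" if "w < n" for w
    proof -
      have "[int u - int w = 1] (mod int n) \<longleftrightarrow> [int w = int u - 1] (mod int n)"
        using dvd_minus_iff[of "int n" "int u - int w - 1"]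
        by (simp add: cong_iff_dvd_diff algebra_simps)
      also have "\<dots> \<longleftrightarrow> [int w = int t] (mod int n)"
        using t cong_sym cong_trans by blast
      finally show ?thesis
        using cong_less_imp_eq[OF that lt(2)] by auto
    qed
    moreover have "[int u - int w = - 1] (mod int n) \<longleftrightarrow> w = s" if "w < n" for w
    proof -
      have "[int u - int w = - 1] (mod int n) \<longleftrightarrow> [int w = int u + 1] (mod int n)"
        using dvd_minus_iff[of "int n" "int u - int w + 1"]
        by (simp add: cong_iff_dvd_diff algebra_simps)
      also have "\<dots> \<longleftrightarrow> [int w = int s] (mod int n)"
        using s cong_sym cong_trans by blast
      finally show ?thesis
        using cong_less_imp_eq[OF that lt(1)] by auto
    qed
    ultimately show ?thesis
      using assms lt by (auto simp: cycle_graph_def arcs_ends_def arc_to_ends_def)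
  qed
  ultimately show ?thesis
    using that lt s t by blast
qed

text \<open>Both sides satisfy the same recursion in the first step. The induction fixes
  \<open>v\<close> and lets the start vary; walks through the two neighbours are told apart by their
  heads.\<close>

lemma card_walks_between_cycle_graph:
  assumes "n \<ge> 3" "u < n" "v < n"
  shows "card (walks_between (with_proj (cycle_graph n)) k u v) =
    signed_step_count n k (int v - int u)"
  using assms(2)
proof (induction k arbitrary: u)
  case 0
  have "int n dvd int v - int u \<longleftrightarrow> u = v"
    using cong_less_imp_eq[OF assms(3) 0] by (auto simp: cong_iff_dvd_diff)
  with 0 show ?case
    by (auto simp: walks_between_0 signed_step_count_0 cycle_graph_def)
next
  case (Suc k)
  let ?G = "with_proj (cycle_graph n)"
  have "pair_graph (cycle_graph n)"
    using assms(1) by (intro pair_graph_cycle_graph) simp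
  then interpret pair_graph "cycle_graph n" .
  obtain s t where st: "s < n" "t < n" "s \<noteq> t"
    "[int s = int u + 1] (mod int n)" "[int t = int u - 1] (mod int n)"
    "{w. (u, w) \<in> arcs_ends ?G} = {s, t}"
    using cycle_graph_neighbours[OF assms(1) Suc.prems] .
  have disj: "walks_between ?G k s v \<inter> walks_between ?G k t v = {}"
    using st(3) by (auto simp: walks_between_def)
  have "card (walks_between ?G (Suc k) u v) =
      card (walks_between ?G k s v) + card (walks_between ?G k t v)"
    unfolding walks_between_Suc[OF wf_digraph_axioms] st(6)
    by (simp add: card_image card_Un_disjoint finite_walks_between[OF fin_digraph_axioms] disj)
  also have "\<dots> = signed_step_count n k (int v - int s) + signed_step_count n k (int v - int t)"
    using Suc.IH st(1,2) by simp
  \<comment> \<open>Because of wrap-around, \<open>s\<close> equals \<open>u + 1\<close> only modulo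
    \<open>n\<close>, which is all that the count depends on.\<close>
  also have "signed_step_count n k (int v - int s) = signed_step_count n k (int v - int u - 1)"
    using cong_diff[OF cong_refl st(4), of "int v"]
    by (intro signed_step_count_cong) (simp add: algebra_simps)
  also have "signed_step_count n k (int v - int t) = signed_step_count n k (int v - int u + 1)"
    using cong_diff[OF cong_refl st(5), of "int v"]
    by (intro signed_step_count_cong) (simp add: algebra_simps)
  finally show ?case
    by (simp add: signed_step_count_Suc)
qed

text \<open>Closed walks are partitioned by their base vertex; each of the \<open>n\<close> classes
  has displacement 0 and hence the same size.\<close>

lemma card_closed_walks_cycle_graph:
  assumes "n \<ge> 3"
  shows "card (closed_walks (with_proj (cycle_graph n)) k) = n * signed_step_count n k 0"
proof -
  let ?G = "with_proj (cycle_graph n)"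
  have "pair_graph (cycle_graph n)"
    using assms by (intro pair_graph_cycle_graph) simp
  then interpret pair_graph "cycle_graph n" .
  have "closed_walks ?G k = (\<Union>u<n. walks_between ?G k u u)"
    by (auto simp: closed_walks_def walks_between_def vwalk_def cycle_graph_def)
      (metis hd_in_set lessThan_iff subsetD)
  also have "card \<dots> = (\<Sum>u<n. card (walks_between ?G k u u))"
    by (rule card_UN_disjoint)
      (auto simp: finite_walks_between[OF fin_digraph_axioms], auto simp: walks_between_def)
  also have "\<dots> = n * signed_step_count n k 0"
    using assms by (simp add: card_walks_between_cycle_graph)
  finally show ?thesis .
qed

section \<open>Evaluation for even length\<close>

text \<open>The interval from 0 to \<open>2 * m\<close> is centred at \<open>m\<close>, so the class
  of \<open>m\<close> extends equally far on both sides, namely \<open>m div n\<close> multiples of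
  \<open>n\<close>.\<close>

lemma residue_class_in_symmetric_range:
  fixes n m :: nat
  assumes "n > 0"
  shows "{j. j \<le> 2 * m \<and> int n dvd int m - int j} =
    {m} \<union> (\<lambda>r. m - r * n) ` {1..m div n} \<union> (\<lambda>r. m + r * n) ` {1..m div n}"
    (is "?L = ?R")
proof (intro equalityI subsetI)
  fix j assume "j \<in> ?L"
  then have j: "j \<le> 2 * m" and "int n dvd int m - int j" by auto
  then obtain q where q: "int m - int j = int n * q" by (auto elim: dvdE)
  consider "j = m" | "j < m" | "j > m" by linarith
  then show "j \<in> ?R"
  proof cases
    case 2
    then have "q > 0"
      using q assms
      by (metis diff_gt_0_iff_gt of_nat_0_less_iff of_nat_less_iff zero_less_mult_pos)
    then have "int m = int (j + nat q * n)" using q by (simp add: algebra_simps)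
    then have m: "m = j + nat q * n" by linarith
    then have "nat q \<le> m div n"
      using assms by (simp add: less_eq_div_iff_mult_less_eq)
    with m \<open>q > 0\<close> show ?thesis by (auto intro!: image_eqI[of _ _ "nat q"])
  next
    case 3
    then have "q < 0"
      using q assms
      by (metis diff_less_0_iff_less mult_nonneg_nonneg not_less of_nat_0_le_iff of_nat_less_iff)
    then have "int j = int (m + nat (- q) * n)" using q by (simp add: algebra_simps)
    then have m: "j = m + nat (- q) * n" by linarith
    with j have "nat (- q) \<le> m div n"
      using assms by (simp add: less_eq_div_iff_mult_less_eq)
    with m \<open>q < 0\<close> show ?thesis by (auto intro!: image_eqI[of _ _ "nat (- q)"])
  qed simp
next
  fix j assume "j \<in> ?R"
  \<comment> \<open>This bound keeps the natural subtraction \<open>m - r * n\<close> from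
    truncating and \<open>m + r * n\<close> within \<open>2 * m\<close>.\<close>
  moreover have "r * n \<le> m" if "r \<le> m div n" for r
    using that assms by (simp add: less_eq_div_iff_mult_less_eq)
  ultimately show "j \<in> ?L"
    by (auto simp: of_nat_diff)
qed

lemma signed_step_count_even_length:
  assumes "n > 0" "odd n"
  shows "signed_step_count n (2 * m) 0 =
    (2 * m choose m) + 2 * (\<Sum>r = 1..m div n. 2 * m choose (m - r * n))"
proof -
  let ?I = "{1..m div n}" and ?f = "\<lambda>r. m - r * n" and ?g = "\<lambda>r. m + r * n"
  have le: "r * n \<le> m" if "r \<in> ?I" for r
    using that assms by (simp add: less_eq_div_iff_mult_less_eq)
  have pos: "r * n > 0" if "r \<in> ?I" for r
    using that assms by simp
  \<comment> \<open>Truncated subtraction makes \<open>?f\<close> injective only where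
    \<open>r * n \<le> m\<close>, hence the appeal to \<open>le\<close>.\<close>
  have inj: "inj_on ?f ?I" "inj_on ?g ?I"
    using assms le
    by (auto intro!: inj_onI) (metis diff_diff_cancel mult_right_cancel neq0_conv)
  have f_less: "?f r < m" and g_greater: "?g r > m" if "r \<in> ?I" for r
    using pos[OF that] le[OF that] by linarith+
  have disj: "({m} \<union> ?f ` ?I) \<inter> ?g ` ?I = {}" "m \<notin> ?f ` ?I"
    using f_less g_greater by fastforce+
  \<comment> \<open>Oddness enters here: 2 can be cancelled modulo \<open>n\<close>, so the
    condition on \<open>2 * m - 2 * j\<close> becomes one on \<open>m - j\<close>.\<close>
  have "coprime (int n) 2"
    using assms by (simp add: coprime_commute)
  then have "int n dvd 2 * int m - 2 * int j \<longleftrightarrow> int n dvd int m - int j" for j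
    using coprime_dvd_mult_right_iff[of "int n" 2 "int m - int j"]
    by (simp only: right_diff_distrib)
  then have "signed_step_count n (2 * m) 0 =
      (\<Sum>j | j \<le> 2 * m \<and> int n dvd int m - int j. 2 * m choose j)"
    unfolding signed_step_count_def by (simp add: sum.inter_filter[symmetric])
  also have "\<dots> = (2 * m choose m) + (\<Sum>r\<in>?I. 2 * m choose ?f r) + (\<Sum>r\<in>?I. 2 * m choose ?g r)"
    unfolding residue_class_in_symmetric_range[OF assms(1)]
    using disj by (simp add: sum.union_disjoint sum.reindex[OF inj(1)] sum.reindex[OF inj(2)]
        del: One_nat_def)
  \<comment> \<open>The reflection of \<open>j\<close> to \<open>2 * m - j\<close> exchanges
    \<open>m + r * n\<close> and \<open>m - r * n\<close>.\<close>
  also have "(\<Sum>r\<in>?I. 2 * m choose ?g r) = (\<Sum>r\<in>?I. 2 * m choose ?f r)"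
  proof (rule sum.cong[OF refl])
    fix r assume "r \<in> ?I"
    then show "2 * m choose ?g r = 2 * m choose ?f r"
      using le[of r] binomial_symmetric[of "?g r" "2 * m"] by simp
  qed
  finally show ?thesis by simp
qed

text \<open>Pascal's rule splits the central coefficient into two neighbours in row
  \<open>2 * m - 1\<close>, which are equal by symmetry.\<close>

lemma central_binomial_eq_double:
  assumes "m \<ge> 1"
  shows "2 * m choose m = 2 * ((2 * m - 1) choose (m - 1))"
proof -
  obtain k where k: "m = Suc k"
    using assms by (cases m) auto
  have "Suc (2 * k) choose k = Suc (2 * k) choose Suc k"
    using binomial_symmetric[of k "Suc (2 * k)"] by simp
  with k show ?thesis by simp
qed

theorem theorem5p2:
  fixes n m :: nat
  assumes "n \<ge> 3" and "odd n" and "m \<ge> 1"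
  shows "card (closed_walks (with_proj (cycle_graph n)) (2 * m)) =
    (if m \<ge> n
     then 2 * n * (((2 * m - 1) choose (m - 1)) +
            (\<Sum>r = 1..m div n. (2 * m) choose (m - r * n)))
     else 2 * n * ((2 * m - 1) choose (m - 1)))"
proof -
  \<comment> \<open>One formula serves both branches: for \<open>m < n\<close> the bound
    \<open>m div n\<close> is 0 and the sum is empty.\<close>
  have "n * signed_step_count n (2 * m) 0 =
      2 * n * (((2 * m - 1) choose (m - 1)) + (\<Sum>r = 1..m div n. (2 * m) choose (m - r * n)))"
    using assms by (simp add: signed_step_count_even_length central_binomial_eq_double
        distrib_left del: One_nat_def)
  then show ?thesis
    using assms by (simp add: card_closed_walks_cycle_graph)
qed

end
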